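(* Let $K$ be an extremally disconnected compact Hausdorff space and let $A$ be a non-empty subset of $C^\infty(K)_+$. Then $A$ is bounded above in $C^\infty(K)$ if and only if for every non-empty clopen subset $U$ of $K$ there exist a non-empty clopen set $V\subseteq U$ and a real number $r\geqslant 0$ such that $f(t)\leqslant r$ for all $f\in A$ and $t\in V$.
   Context: A compact Hausdorff space $K$ is extremally disconnected if the closure of every open set is open. $C^\infty(K)$ is the set of all continuous functions from $K$ to $\overline{\mathbb R}=[-\infty,\infty]$ that are finite except on a nowhere dense set, ordered pointwise (it is a universally complete vector lattice). $C^\infty(K)_+$ denotes the set of its non-negative elements. *)

theory Defs
  imports "HOL-Analysis.Analysis"
begin

definition extremally_disconnected_space :: "'a topology \<Rightarrow> bool" where
  "extremally_disconnected_space K \<longleftrightarrow> (\<forall>U. openin K U \<longrightarrow> openin K (K closure_of U))"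

definition clopenin :: "'a topology \<Rightarrow> 'a set \<Rightarrow> bool" where
  "clopenin K U \<longleftrightarrow> openin K U \<and> closedin K U"

definition nowhere_densein :: "'a topology \<Rightarrow> 'a set \<Rightarrow> bool" where
  "nowhere_densein K S \<longleftrightarrow> S \<subseteq> topspace K \<and> K interior_of (K closure_of S) = {}"

(* Membership in extensional fixes the irrelevant values off topspace K, so that elements
   of C_infinity K correspond one-to-one to functions from K to the extended reals. *)
definition C_infinity :: "'a topology \<Rightarrow> ('a \<Rightarrow> ereal) set" where
  "C_infinity K = {f \<in> extensional (topspace K).
     continuous_map K euclidean f \<and> nowhere_densein K {t \<in> topspace K. \<bar>f t\<bar> = \<infinity>}}"

definition pointwise_le :: "'a topology \<Rightarrow> ('a \<Rightarrow> ereal) \<Rightarrow> ('a \<Rightarrow> ereal) \<Rightarrow> bool" where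
  "pointwise_le K f g \<longleftrightarrow> (\<forall>t \<in> topspace K. f t \<le> g t)"

definition C_infinity_nonneg :: "'a topology \<Rightarrow> ('a \<Rightarrow> ereal) set" where
  "C_infinity_nonneg K = {f \<in> C_infinity K. pointwise_le K (\<lambda>t. 0) f}"

definition bounded_above_C_infinity :: "'a topology \<Rightarrow> ('a \<Rightarrow> ereal) set \<Rightarrow> bool" where
  "bounded_above_C_infinity K A \<longleftrightarrow> (\<exists>g \<in> C_infinity K. \<forall>f \<in> A. pointwise_le K f g)"

end

theory Submission
  imports Defs
begin

text \<open>
  Suppose first that \<open>g\<close> bounds \<open>A\<close>. A non-empty clopen \<open>U\<close> contains a point \<open>x\<close> at which \<open>g\<close> is
  finite, and \<open>V\<close> is the closure of the set of points of \<open>U\<close> where \<open>g < g x + 1\<close>: extremal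
  disconnectedness makes it open, and continuity preserves the bound on the closure.

  For the converse, the pointwise supremum of \<open>A\<close> is only lower semicontinuous. Its strict
  superlevel sets \<open>{t. \<exists>f\<in>A. r < f t}\<close> are open and decrease with \<open>r\<close>, so their closures
  \<open>C r\<close> form a decreasing family of clopen sets. The function that has this family as its spectral
  family, \<open>t \<mapsto> SUP {r. t \<in> C r}\<close>, is continuous because every \<open>C r\<close> is both open and closed,
  and it dominates \<open>A\<close>. It is infinite only on the intersection of the \<open>C r\<close>. If this
  closed intersection had a non-empty interior, it would contain the clopen closure of that
  interior, hence a non-empty clopen \<open>V\<close> on which \<open>A\<close> is bounded by some \<open>r\<close>; such a \<open>V\<close>
  misses the \<open>r\<close>-th superlevel set and so, being open, misses \<open>C r\<close>.
\<close>

text \<open>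
  Strict inequalities leave room for an intermediate real index: \<open>a < g x\<close> is witnessed by
  membership in some \<open>C r\<close> with \<open>a < r\<close>, and \<open>g x < a\<close> by non-membership in some \<open>C r\<close> with
  \<open>r < a\<close>. Thus the openness of the \<open>C r\<close> gives lower, and their closedness upper,
  semicontinuity.
\<close>

lemma continuous_map_SUP_decreasing_clopen:
  fixes C :: "real \<Rightarrow> 'a set"
  assumes clopen: "\<And>r. clopenin X (C r)"
    and decreasing: "\<And>r s. r \<le> s \<Longrightarrow> C s \<subseteq> C r"
  shows "continuous_map X euclidean (\<lambda>x. SUP r\<in>{r. x \<in> C r}. ereal r)"
    (is "continuous_map X euclidean ?g")
proof (unfold continuous_map_upper_lower_semicontinuous_lt, intro conjI allI)
  fix a :: ereal
  have eq: "{x \<in> topspace X. ?g x < a} = (\<Union>r\<in>{r. ereal r < a}. topspace X - C r)"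
  proof (intro set_eqI iffI)
    fix x assume x: "x \<in> {x \<in> topspace X. ?g x < a}"
    then obtain r where r: "?g x < ereal r" "ereal r < a"
      using ereal_dense2 by blast
    have "x \<notin> C r"
      using r(1) SUP_upper[of r "{r. x \<in> C r}" ereal] by auto
    then show "x \<in> (\<Union>r\<in>{r. ereal r < a}. topspace X - C r)"
      using r x by auto
  next
    fix x assume "x \<in> (\<Union>r\<in>{r. ereal r < a}. topspace X - C r)"
    then obtain r where r: "ereal r < a" "x \<in> topspace X" "x \<notin> C r" by auto
    have "?g x \<le> ereal r"
    proof (rule SUP_least)
      fix s assume "s \<in> {r. x \<in> C r}"
      then show "ereal s \<le> ereal r"
        using decreasing[of r s] r(3) by (cases "r \<le> s") auto
    qed
    then show "x \<in> {x \<in> topspace X. ?g x < a}" using r by auto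
  qed
  show "openin X {x \<in> topspace X. ?g x < a}"
    unfolding eq using clopen by (intro openin_Union) (auto simp: clopenin_def)
  have "C r \<subseteq> topspace X" for r
    using clopen[of r] openin_subset by (auto simp: clopenin_def)
  then have eq': "{x \<in> topspace X. a < ?g x} = (\<Union>r\<in>{r. a < ereal r}. C r)"
    by (auto simp: less_SUP_iff)
  show "openin X {x \<in> topspace X. a < ?g x}"
    unfolding eq' using clopen by (intro openin_Union) (auto simp: clopenin_def)
qed

lemma clopenin_closure_of:
  assumes "extremally_disconnected_space X" "openin X U"
  shows "clopenin X (X closure_of U)"
  using assms by (simp add: extremally_disconnected_space_def clopenin_def)

lemma openin_meets_complement_nowhere_densein:
  assumes "nowhere_densein X S" "openin X U" "U \<noteq> {}"
  obtains x where "x \<in> U" "x \<notin> S"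
proof -
  have "\<not> U \<subseteq> S"
  proof
    assume "U \<subseteq> S"
    then have "U \<subseteq> X closure_of S"
      using assms(1) closure_of_subset by (force simp: nowhere_densein_def)
    then show False
      using assms interior_of_maximal by (fastforce simp: nowhere_densein_def)
  qed
  then show thesis using that by blast
qed

text \<open>
  The points of \<open>U\<close> where \<open>g\<close> lies below a fixed real \<open>r\<close> form an open set, and it is non-empty
  once \<open>r\<close> exceeds one finite value of \<open>g\<close> on \<open>U\<close>. Taking its closure makes it clopen without
  enlarging the bound, because \<open>{t \<in> U. g t \<le> r}\<close> is already closed.
\<close>

lemma C_infinity_locally_bounded_above:
  assumes ed: "extremally_disconnected_space K" and g: "g \<in> C_infinity K"
    and nonneg: "\<And>t. t \<in> topspace K \<Longrightarrow> 0 \<le> g t"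
    and U: "clopenin K U" "U \<noteq> {}"
  obtains V and r :: real where "clopenin K V" "V \<noteq> {}" "V \<subseteq> U" "0 \<le> r"
    "\<And>t. t \<in> V \<Longrightarrow> g t \<le> ereal r"
proof -
  have cont: "continuous_map K euclidean g"
    and nd: "nowhere_densein K {t \<in> topspace K. \<bar>g t\<bar> = \<infinity>}"
    using g by (auto simp: C_infinity_def)
  have UK: "openin K U" "closedin K U" "U \<subseteq> topspace K"
    using U openin_subset by (auto simp: clopenin_def)
  obtain x where x: "x \<in> U" "\<bar>g x\<bar> \<noteq> \<infinity>"
    using openin_meets_complement_nowhere_densein[OF nd UK(1) U(2)] UK(3) by blast
  define r where "r = real_of_ereal (g x) + 1"
  have r: "0 \<le> r" "g x < ereal r"
    using x nonneg[of x] UK(3) by (cases "g x"; force simp: r_def)+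
  define W where "W = U \<inter> {t \<in> topspace K. g t \<in> {..<ereal r}}"
  have W: "openin K W"
    unfolding W_def using UK(1) openin_continuous_map_preimage[OF cont, of "{..<ereal r}"]
    by auto
  have "closedin K (U \<inter> {t \<in> topspace K. g t \<in> {..ereal r}})"
    using UK(2) closedin_continuous_map_preimage[OF cont, of "{..ereal r}"]
    by auto
  moreover have "W \<subseteq> U \<inter> {t \<in> topspace K. g t \<in> {..ereal r}}"
    by (auto simp: W_def)
  ultimately have sub: "K closure_of W \<subseteq> U \<inter> {t \<in> topspace K. g t \<in> {..ereal r}}"
    by (rule closure_of_minimal[rotated])
  have "x \<in> W" using x r UK by (auto simp: W_def)
  then have "K closure_of W \<noteq> {}"
    using closure_of_subset[OF openin_subset[OF W]] by blast
  show thesis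
  proof (rule that)
    show "clopenin K (K closure_of W)" by (rule clopenin_closure_of[OF ed W])
    show "K closure_of W \<noteq> {}" by fact
    show "K closure_of W \<subseteq> U" using sub by blast
    show "0 \<le> r" by fact
    show "g t \<le> ereal r" if "t \<in> K closure_of W" for t using sub that by blast
  qed
qed

lemma openin_SUP_superlevel:
  assumes "A \<subseteq> C_infinity K"
  shows "openin K {t \<in> topspace K. \<exists>f\<in>A. a < f t}"
proof -
  have "openin K {t \<in> topspace K. f t \<in> {a<..}}" if "f \<in> A" for f
    by (rule openin_continuous_map_preimage) (use assms that in \<open>auto simp: C_infinity_def\<close>)
  then have "openin K (\<Union>f\<in>A. {t \<in> topspace K. f t \<in> {a<..}})" by blast
  moreover have "(\<Union>f\<in>A. {t \<in> topspace K. f t \<in> {a<..}}) = {t \<in> topspace K. \<exists>f\<in>A. a < f t}"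
    by auto
  ultimately show ?thesis by simp
qed

text \<open>
  The bound is the function whose superlevel sets are governed by the clopen hulls \<open>C r\<close> of the
  superlevel sets \<open>P r\<close> of the pointwise supremum of \<open>A\<close>. The local bounds make it finite
  off a nowhere dense set: an open set disjoint from \<open>P r\<close> is disjoint from the closure \<open>C r\<close>
  too, whereas a point with value \<open>\<infinity>\<close> lies in every \<open>C r\<close>.
\<close>

lemma bounded_above_C_infinity_if_locally_bounded_above:
  assumes ed: "extremally_disconnected_space K"
    and A: "A \<noteq> {}" "A \<subseteq> C_infinity_nonneg K"
    and locally_bounded: "\<And>U. clopenin K U \<Longrightarrow> U \<noteq> {} \<Longrightarrow>
      \<exists>V (r::real). clopenin K V \<and> V \<noteq> {} \<and> V \<subseteq> U \<and> (\<forall>f\<in>A. \<forall>t\<in>V. f t \<le> ereal r)"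
  shows "bounded_above_C_infinity K A"
proof -
  define P where "P r = {t \<in> topspace K. \<exists>f\<in>A. ereal r < f t}" for r
  define C where "C r = K closure_of (P r)" for r
  define g where "g x = (SUP r\<in>{r. x \<in> C r}. ereal r)" for x
  have P: "openin K (P r)" for r
    unfolding P_def using A(2) by (intro openin_SUP_superlevel) (auto simp: C_infinity_nonneg_def)
  have PC: "P r \<subseteq> C r" for r
    unfolding C_def by (rule closure_of_subset[OF openin_subset[OF P]])
  have clopen: "clopenin K (C r)" for r
    unfolding C_def by (rule clopenin_closure_of[OF ed P])
  have decreasing: "C s \<subseteq> C r" if "r \<le> s" for r s
    unfolding C_def
  proof (rule closure_of_mono)
    show "P s \<subseteq> P r"
      using that le_less_trans[of "ereal r" "ereal s"] unfolding P_def by auto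
  qed
  have cont: "continuous_map K euclidean g"
    unfolding g_def using clopen decreasing by (rule continuous_map_SUP_decreasing_clopen)
  have bound: "f t \<le> g t" if "f \<in> A" "t \<in> topspace K" for f t
  proof (rule ccontr)
    assume "\<not> f t \<le> g t"
    then obtain r where r: "g t < ereal r" "ereal r < f t"
      using ereal_dense2 by (meson not_le)
    then have "t \<in> C r" using that PC[of r] by (auto simp: P_def)
    then have "ereal r \<le> g t" unfolding g_def by (intro SUP_upper) auto
    then show False using r by simp
  qed
  have nonneg: "0 \<le> g t" if "t \<in> topspace K" for t
  proof -
    obtain f where "f \<in> A" using A(1) by blast
    then have "0 \<le> f t" using A(2) that
      by (auto simp: C_infinity_nonneg_def pointwise_le_def)
    then show ?thesis using bound[OF \<open>f \<in> A\<close> that] by (rule order_trans)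
  qed
  define S where "S = {t \<in> topspace K. \<bar>g t\<bar> = \<infinity>}"
  \<comment> \<open>The value \<open>-\<infinity>\<close> is excluded by non-negativity, which leaves the preimage of a closed set.\<close>
  have S_eq: "S = {t \<in> topspace K. g t \<in> {\<infinity>}}"
    using nonneg by (auto simp: S_def)
  have S_closed: "closedin K S"
    unfolding S_eq using cont by (rule closedin_continuous_map_preimage) simp
  have "K interior_of S = {}"
  proof (rule ccontr)
    assume ne: "K interior_of S \<noteq> {}"
    let ?U = "K closure_of (K interior_of S)"
    have "clopenin K ?U"
      by (rule clopenin_closure_of[OF ed openin_interior_of])
    moreover have "?U \<noteq> {}"
      using ne closure_of_subset[OF interior_of_subset_topspace[of K S]] by blast
    ultimately obtain V r where V: "clopenin K V" "V \<noteq> {}" "V \<subseteq> ?U"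
      and r: "\<forall>f\<in>A. \<forall>t\<in>V. f t \<le> ereal r"
      using locally_bounded by blast
    have "?U \<subseteq> S"
      using S_closed interior_of_subset by (metis closure_of_minimal)
    then obtain x where x: "x \<in> V" "g x = \<infinity>"
      using V S_eq by blast
    have "ereal r < g x" using x by simp
    then obtain s where "x \<in> C s" "r < s"
      unfolding g_def less_SUP_iff by auto
    then have "x \<in> C r" using decreasing[of r s] by auto
    moreover have "V \<inter> P r = {}" using r unfolding P_def by (auto simp: not_less[symmetric])
    then have "V \<inter> C r = {}"
      using V(1) unfolding C_def clopenin_def by (simp add: openin_Int_closure_of_eq_empty)
    ultimately show False using x by blast
  qed
  then have nd: "nowhere_densein K S"
    using S_closed by (simp add: nowhere_densein_def closure_of_closedin closedin_subset)
  \<comment> \<open>Elements of \<open>C_infinity K\<close> have a fixed value off \<open>topspace K\<close>.\<close>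
  define h where "h = restrict g (topspace K)"
  have "continuous_map K euclidean h"
    using cont by (rule continuous_map_eq) (simp add: h_def)
  moreover have "{t \<in> topspace K. \<bar>h t\<bar> = \<infinity>} = S"
    by (auto simp: h_def S_def)
  ultimately have "h \<in> C_infinity K"
    using nd by (auto simp: C_infinity_def h_def)
  moreover have "\<forall>f\<in>A. pointwise_le K f h"
    using bound by (simp add: pointwise_le_def h_def)
  ultimately show ?thesis
    unfolding bounded_above_C_infinity_def by blast
qed

theorem proposition4p2:
  fixes K :: "'a topology" and A :: "('a \<Rightarrow> ereal) set"
  assumes "compact_space K" and "Hausdorff_space K" and "extremally_disconnected_space K"
    and "A \<noteq> {}" and "A \<subseteq> C_infinity_nonneg K"
  shows "bounded_above_C_infinity K A \<longleftrightarrow>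
    (\<forall>U. clopenin K U \<and> U \<noteq> {} \<longrightarrow>
      (\<exists>V (r::real). clopenin K V \<and> V \<noteq> {} \<and> V \<subseteq> U \<and> r \<ge> 0 \<and>
        (\<forall>f \<in> A. \<forall>t \<in> V. f t \<le> ereal r)))"
proof (intro iffI allI impI)
  fix U
  assume "bounded_above_C_infinity K A" and U: "clopenin K U \<and> U \<noteq> {}"
  then obtain g where g: "g \<in> C_infinity K"
    and bound: "\<And>f t. f \<in> A \<Longrightarrow> t \<in> topspace K \<Longrightarrow> f t \<le> g t"
    by (auto simp: bounded_above_C_infinity_def pointwise_le_def)
  obtain f where f: "f \<in> A" using assms(4) by blast
  have "0 \<le> g t" if "t \<in> topspace K" for t
  proof -
    have "0 \<le> f t" using assms(5) f that
      by (auto simp: C_infinity_nonneg_def pointwise_le_def)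
    then show ?thesis using bound[OF f that] by (rule order_trans)
  qed
  then obtain V r where V: "clopenin K V" "V \<noteq> {}" "V \<subseteq> U" "0 \<le> r"
    and r: "\<And>t. t \<in> V \<Longrightarrow> g t \<le> ereal r"
    using C_infinity_locally_bounded_above[OF assms(3) g] U by metis
  have "V \<subseteq> topspace K" using V(1) openin_subset by (auto simp: clopenin_def)
  then have "\<forall>f\<in>A. \<forall>t\<in>V. f t \<le> ereal r"
    using bound r by (meson order_trans subsetD)
  then show "\<exists>V (r::real). clopenin K V \<and> V \<noteq> {} \<and> V \<subseteq> U \<and> r \<ge> 0 \<and>
      (\<forall>f \<in> A. \<forall>t \<in> V. f t \<le> ereal r)"
    using V by blast
next
  assume *: "\<forall>U. clopenin K U \<and> U \<noteq> {} \<longrightarrow>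
      (\<exists>V (r::real). clopenin K V \<and> V \<noteq> {} \<and> V \<subseteq> U \<and> r \<ge> 0 \<and>
        (\<forall>f \<in> A. \<forall>t \<in> V. f t \<le> ereal r))"
  show "bounded_above_C_infinity K A"
    by (rule bounded_above_C_infinity_if_locally_bounded_above[OF assms(3-5)]) (use * in meson)
qed

end
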